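(* Let $a\in\mathbb N^n$ be a weak composition and $1\le i<n$. For every $T\in\mathrm{SSKD}(a)$ with $e_i(T)\ne0$, we have $e_i(T)\in\mathrm{SSKD}(a)$ and $\mathrm{maj}(e_i(T))=\mathrm{maj}(T)$. That is, $e_i:\mathrm{SSKD}(a)\to\mathrm{SSKD}(a)\cup\{0\}$ is a well-defined $\mathrm{maj}$-preserving map.
   Context: The diagram of $a$ has cells $(r,c)$ (row $r$ from the bottom, column $c$ from the left) with $1\le c\le a_r$, augmented (following Haglund–Haiman–Loehr) by a basement column $0$ whose cell $(r,0)$ contains $r$, basement cells being included in the conditions below (row lengths compared without basement). Fillings have entries in $\{1,\dots,n\}$. Cells attack if in the same column, or in adjacent columns with the left cell strictly higher; non-attacking: attacking cells have different entries. A triple: cells $(r,c),(r,c+1)$ with entries $i,j$ and a third with entry $k$, either $(s,c)$, $s>r$, row $r$ strictly longer than row $s$ (Type I), or $(s,c+1)$, $s<r$, row $r$ weakly longer than row $s$ (Type II); co-inversion if $i<j<k$, $j<k<i$ or $k<i<j$. $\mathrm{SSKD}(a)$: non-attacking fillings with no co-inversion triples. $\mathrm{maj}(T)=\sum(a_r-c)$ over cells $(r,c)$ with $(r,c+1)$ in the diagram and $T(r,c)<T(r,c+1)$. $i$-pairing: pair an $i$ and an $i+1$ in the same column, then iteratively pair an unpaired $i+1$ with an unpaired $i$ to its left whenever all entries $i,i+1$ between them are paired. Raising $e_i$: $e_i(T)=0$ if $T$ has no unpaired $i+1$; otherwise change the rightmost unpaired $i+1$ to $i$, swap $i,i+1$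 in each of the consecutive columns immediately to its left having an $i+1$ in the same row and an $i$ above, and in each of the consecutive columns immediately to its right having an $i+1$ in the same row and an $i$ below. *)

theory Defs
  imports "HOL-Library.FuncSet" "HOL-Combinatorics.Transposition"
begin

text \<open>
  A weak composition of length \<open>n\<close> is a function \<open>a :: nat \<Rightarrow> nat\<close> of which only the values at
  \<open>1, \<dots>, n\<close> are used. A cell is a pair (row, column); rows are counted from the bottom and columns
  from the left. Column 0 is the basement.
\<close>

type_synonym cell = "nat \<times> nat"
type_synonym filling = "cell \<Rightarrow> nat"

definition diagram :: "nat \<Rightarrow> (nat \<Rightarrow> nat) \<Rightarrow> cell set" where
  "diagram n a = {(r, c). 1 \<le> r \<and> r \<le> n \<and> 1 \<le> c \<and> c \<le> a r}"

definition aug_diagram :: "nat \<Rightarrow> (nat \<Rightarrow> nat) \<Rightarrow> cell set" where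
  "aug_diagram n a = {(r, c). 1 \<le> r \<and> r \<le> n \<and> c \<le> a r}"

text \<open>A filling is extensional on the diagram; the basement entries are supplied by \<open>entry\<close>.\<close>

definition fillings :: "nat \<Rightarrow> (nat \<Rightarrow> nat) \<Rightarrow> filling set" where
  "fillings n a = (diagram n a \<rightarrow>\<^sub>E {1..n})"

fun entry :: "filling \<Rightarrow> cell \<Rightarrow> nat" where
  "entry T (r, c) = (if c = 0 then r else T (r, c))"

text \<open>The case where the roles of the two cells are exchanged is covered by quantifying over all
  pairs of cells in \<open>non_attacking\<close>.\<close>

fun attack :: "cell \<Rightarrow> cell \<Rightarrow> bool" where
  "attack (r, c) (s, d) \<longleftrightarrow> (c = d \<and> r \<noteq> s) \<or> (d = c + 1 \<and> r > s)"

definition non_attacking :: "nat \<Rightarrow> (nat \<Rightarrow> nat) \<Rightarrow> filling \<Rightarrow> bool" where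
  "non_attacking n a T \<longleftrightarrow>
     (\<forall>x \<in> aug_diagram n a. \<forall>y \<in> aug_diagram n a. attack x y \<longrightarrow> entry T x \<noteq> entry T y)"

definition coinv_order :: "nat \<Rightarrow> nat \<Rightarrow> nat \<Rightarrow> bool" where
  "coinv_order i j k \<longleftrightarrow> (i < j \<and> j < k) \<or> (j < k \<and> k < i) \<or> (k < i \<and> i < j)"

text \<open>In both types the triple consists of \<open>(r, c)\<close>, \<open>(r, c + 1)\<close> and a third cell in row \<open>s\<close>,
  which lies in column \<open>c\<close> for type I and in column \<open>c + 1\<close> for type II.\<close>

definition type_I_triple :: "nat \<Rightarrow> (nat \<Rightarrow> nat) \<Rightarrow> nat \<Rightarrow> nat \<Rightarrow> nat \<Rightarrow> bool" where
  "type_I_triple n a r s c \<longleftrightarrow>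
     {(r, c), (r, c + 1), (s, c)} \<subseteq> aug_diagram n a \<and> s > r \<and> a r > a s"

definition type_II_triple :: "nat \<Rightarrow> (nat \<Rightarrow> nat) \<Rightarrow> nat \<Rightarrow> nat \<Rightarrow> nat \<Rightarrow> bool" where
  "type_II_triple n a r s c \<longleftrightarrow>
     {(r, c), (r, c + 1), (s, c + 1)} \<subseteq> aug_diagram n a \<and> s < r \<and> a r \<ge> a s"

definition no_coinv_triples :: "nat \<Rightarrow> (nat \<Rightarrow> nat) \<Rightarrow> filling \<Rightarrow> bool" where
  "no_coinv_triples n a T \<longleftrightarrow>
     (\<forall>r s c. type_I_triple n a r s c \<longrightarrow>
        \<not> coinv_order (entry T (r, c)) (entry T (r, c + 1)) (entry T (s, c))) \<and>
     (\<forall>r s c. type_II_triple n a r s c \<longrightarrow>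
        \<not> coinv_order (entry T (r, c)) (entry T (r, c + 1)) (entry T (s, c + 1)))"

definition SSKD :: "nat \<Rightarrow> (nat \<Rightarrow> nat) \<Rightarrow> filling set" where
  "SSKD n a = {T \<in> fillings n a. non_attacking n a T \<and> no_coinv_triples n a T}"

text \<open>Basement cells \<open>(r, 0)\<close> are allowed here. They contribute nothing for a non-attacking
  filling, see \<open>maj_no_basement\<close>.\<close>

definition maj :: "nat \<Rightarrow> (nat \<Rightarrow> nat) \<Rightarrow> filling \<Rightarrow> nat" where
  "maj n a T =
     (\<Sum>(r, c) \<in> {(r, c). (r, c) \<in> aug_diagram n a \<and> (r, c + 1) \<in> diagram n a \<and>
                         entry T (r, c) < entry T (r, c + 1)}. a r - c)"

lemma non_attacking_first_column:
  assumes "T \<in> fillings n a" "non_attacking n a T" "(r, 1) \<in> diagram n a"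
  shows "T (r, 1) \<le> r"
proof (rule ccontr)
  assume "\<not> T (r, 1) \<le> r"
  moreover have "T (r, 1) \<le> n"
    using assms(1,3) by (auto simp: fillings_def PiE_def Pi_def)
  ultimately have "(T (r, 1), 0) \<in> aug_diagram n a" "attack (T (r, 1), 0) (r, 1)"
    "(r, 1) \<in> aug_diagram n a"
    using assms(3) by (auto simp: aug_diagram_def diagram_def)
  with assms(2) have "entry T (T (r, 1), 0) \<noteq> entry T (r, 1)"
    unfolding non_attacking_def by blast
  then show False by simp
qed

lemma maj_no_basement:
  assumes "T \<in> fillings n a" "non_attacking n a T"
  shows "maj n a T =
     (\<Sum>(r, c) \<in> {(r, c). (r, c) \<in> diagram n a \<and> (r, c + 1) \<in> diagram n a \<and>
                         T (r, c) < T (r, c + 1)}. a r - c)"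
  unfolding maj_def
proof (rule sum.cong)
  have "c > 0" if "(r, c + 1) \<in> diagram n a" "entry T (r, c) < entry T (r, c + 1)" for r c
    using non_attacking_first_column[OF assms, of r] that by (cases c) auto
  then show "{(r, c). (r, c) \<in> aug_diagram n a \<and> (r, c + 1) \<in> diagram n a \<and>
                      entry T (r, c) < entry T (r, c + 1)} =
             {(r, c). (r, c) \<in> diagram n a \<and> (r, c + 1) \<in> diagram n a \<and>
                      T (r, c) < T (r, c + 1)}"
    by (fastforce simp: aug_diagram_def diagram_def)
qed auto

text \<open>
  \<open>i_pairs n a i T k\<close> is the set of pairs (cell with entry \<open>i\<close>, cell with entry \<open>i + 1\<close>) obtained
  after \<open>k\<close> rounds. Round 0 pairs within columns. Each later round adds all pairs which are
  eligible at that time; in a non-attacking filling these are disjoint, since after round 0 each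
  column has at most one unpaired entry from \<open>{i, i + 1}\<close>.
\<close>

definition paired_by :: "(cell \<times> cell) set \<Rightarrow> cell \<Rightarrow> bool" where
  "paired_by M x \<longleftrightarrow> x \<in> fst ` M \<union> snd ` M"

primrec i_pairs ::
    "nat \<Rightarrow> (nat \<Rightarrow> nat) \<Rightarrow> nat \<Rightarrow> filling \<Rightarrow> nat \<Rightarrow> (cell \<times> cell) set" where
  "i_pairs n a i T 0 =
     {(x, y). x \<in> diagram n a \<and> y \<in> diagram n a \<and> T x = i \<and> T y = i + 1 \<and> snd x = snd y}"
| "i_pairs n a i T (Suc k) =
     (let M = i_pairs n a i T k in
      M \<union> {(x, y). x \<in> diagram n a \<and> y \<in> diagram n a \<and> T x = i \<and> T y = i + 1 \<and> snd x < snd y \<and>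
                   \<not> paired_by M x \<and> \<not> paired_by M y \<and>
                   (\<forall>z \<in> diagram n a. T z \<in> {i, i + 1} \<and> snd x < snd z \<and> snd z < snd y
                      \<longrightarrow> paired_by M z)})"

definition unpaired_succ :: "nat \<Rightarrow> (nat \<Rightarrow> nat) \<Rightarrow> nat \<Rightarrow> filling \<Rightarrow> cell set" where
  "unpaired_succ n a i T =
     {y \<in> diagram n a. T y = i + 1 \<and> \<not> paired_by (\<Union>k. i_pairs n a i T k) y}"

text \<open>Unique for non-attacking fillings, where the entries of a column are distinct.\<close>

definition rightmost_unpaired :: "nat \<Rightarrow> (nat \<Rightarrow> nat) \<Rightarrow> nat \<Rightarrow> filling \<Rightarrow> cell" where
  "rightmost_unpaired n a i T =
     (THE x. x \<in> unpaired_succ n a i T \<and> (\<forall>y \<in> unpaired_succ n a i T. snd y \<le> snd x))"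

lemma rightmost_unpaired_props:
  assumes "non_attacking n a T" "unpaired_succ n a i T \<noteq> {}"
  shows "rightmost_unpaired n a i T \<in> unpaired_succ n a i T"
    and "\<forall>y \<in> unpaired_succ n a i T. snd y \<le> snd (rightmost_unpaired n a i T)"
proof -
  let ?U = "unpaired_succ n a i T"
  have "diagram n a \<subseteq> (SIGMA r:{..n}. {..a r})" by (auto simp: diagram_def)
  then have fin: "finite (diagram n a)" by (rule finite_subset) auto
  have finU: "finite ?U" by (rule finite_subset[OF _ fin]) (auto simp: unpaired_succ_def)
  from finU assms(2) have "Max (snd ` ?U) \<in> snd ` ?U" by simp
  then obtain x where x: "x \<in> ?U" "snd x = Max (snd ` ?U)" by auto
  have mx: "\<forall>y \<in> ?U. snd y \<le> snd x" using x(2) finU by simp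
  have inj: "y = z" if "y \<in> ?U" "z \<in> ?U" "snd y = snd z" for y z
  proof (rule ccontr)
    assume "y \<noteq> z"
    with that have "attack y z" by (cases y; cases z) auto
    moreover have "y \<in> aug_diagram n a" "z \<in> aug_diagram n a" "entry T y = i + 1" "entry T z = i + 1"
      using that(1,2) by (auto simp: unpaired_succ_def diagram_def aug_diagram_def)
    ultimately show False using assms(1) unfolding non_attacking_def by fastforce
  qed
  have "\<exists>!x. x \<in> ?U \<and> (\<forall>y \<in> ?U. snd y \<le> snd x)"
    using x(1) mx inj by (metis order_antisym)
  from theI'[OF this] show "rightmost_unpaired n a i T \<in> ?U"
    "\<forall>y \<in> ?U. snd y \<le> snd (rightmost_unpaired n a i T)"
    by (auto simp: rightmost_unpaired_def)
qed

definition left_swap_cols :: "nat \<Rightarrow> (nat \<Rightarrow> nat) \<Rightarrow> nat \<Rightarrow> filling \<Rightarrow> cell \<Rightarrow> nat set" where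
  "left_swap_cols n a i T x =
     {d. d < snd x \<and> (\<forall>d' \<in> {d..<snd x}.
           (fst x, d') \<in> diagram n a \<and> T (fst x, d') = i + 1 \<and>
           (\<exists>s > fst x. (s, d') \<in> diagram n a \<and> T (s, d') = i))}"

definition right_swap_cols :: "nat \<Rightarrow> (nat \<Rightarrow> nat) \<Rightarrow> nat \<Rightarrow> filling \<Rightarrow> cell \<Rightarrow> nat set" where
  "right_swap_cols n a i T x =
     {d. snd x < d \<and> (\<forall>d' \<in> {snd x<..d}.
           (fst x, d') \<in> diagram n a \<and> T (fst x, d') = i + 1 \<and>
           (\<exists>s < fst x. (s, d') \<in> diagram n a \<and> T (s, d') = i))}"

text \<open>The raising operator; \<open>None\<close> plays the role of \<open>0\<close>.\<close>

definition raise :: "nat \<Rightarrow> (nat \<Rightarrow> nat) \<Rightarrow> nat \<Rightarrow> filling \<Rightarrow> filling option" where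
  "raise n a i T =
     (if unpaired_succ n a i T = {} then None
      else let x = rightmost_unpaired n a i T in
        Some (\<lambda>y. if y = x then i
                   else if y \<in> diagram n a \<and>
                           snd y \<in> left_swap_cols n a i T x \<union> right_swap_cols n a i T x
                   then transpose i (i + 1) (T y)
                   else T y))"

end

theory Submission
  imports Defs
begin

text \<open>
  Since \<open>i\<close> and \<open>i + 1\<close> are adjacent values, exchanging them only affects triples
  containing both letters, and for these the triple condition says: whenever certain relative
  positions of an \<open>i\<close> and an \<open>i + 1\<close> occur in adjacent columns, a letter has to be repeated along
  its row. Following these repetitions row-wise to the left (down to the basement, or down to the
  column of the unpaired \<open>i + 1\<close>, which contains no \<open>i\<close>) or to the right (beyond the end of the
  row) excludes every bad configuration at the two ends of the block of columns changed by
  \<open>e\<^sub>i\<close>. It also shows that no \<open>i\<close> is directly followed by an \<open>i + 1\<close> in a row at a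
  changed column, before or after raising, which gives the invariance of maj.
\<close>

section \<open>Positions of two adjacent letters\<close>

text \<open>\<open>I p c\<close> and \<open>J p c\<close> say that cell \<open>(p, c)\<close> contains \<open>i\<close> and \<open>i + 1\<close>, respectively.
  The suffix of the names \<open>J_right\<close> and \<open>I_left\<close> is the type of the triple that forces the repetition.\<close>

locale letter_pair =
  fixes a :: "nat \<Rightarrow> nat" and I J :: "nat \<Rightarrow> nat \<Rightarrow> bool"
  assumes disjoint: "I p c \<Longrightarrow> \<not> J p c"
    and I_unique: "I p c \<Longrightarrow> I q c \<Longrightarrow> p = q"
    and J_unique: "J p c \<Longrightarrow> J q c \<Longrightarrow> p = q"
    and I_mono: "I p c \<Longrightarrow> I q (Suc c) \<Longrightarrow> p \<le> q"
    and J_mono: "J p c \<Longrightarrow> J q (Suc c) \<Longrightarrow> p \<le> q"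
    and J_right_I: "J p c \<Longrightarrow> I s c \<Longrightarrow> p < s \<Longrightarrow> a s < a p \<Longrightarrow> J p (Suc c)"
    and J_right_II: "J p c \<Longrightarrow> I s (Suc c) \<Longrightarrow> s < p \<Longrightarrow> a s \<le> a p \<Longrightarrow> J p (Suc c)"
    and I_left_I: "I p (Suc c) \<Longrightarrow> J s c \<Longrightarrow> p < s \<Longrightarrow> a s < a p \<Longrightarrow> I p c"
    and I_left_II: "I p (Suc c) \<Longrightarrow> J s (Suc c) \<Longrightarrow> s < p \<Longrightarrow> a s \<le> a p \<Longrightarrow> I p c"
    and basement: "I p 0 \<Longrightarrow> J q 0 \<Longrightarrow> p < q"
    and I_bound: "I p c \<Longrightarrow> c \<le> a p"
    and J_bound: "J p c \<Longrightarrow> c \<le> a p"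

text \<open>\<open>(r, x)\<close> is the rightmost unpaired \<open>i + 1\<close>. If only columns
  with both letters separate it from an \<open>i\<close> on its left, that \<open>i\<close> must
  have an \<open>i + 1\<close> in its column, as otherwise the two would be paired;
  \<open>pair_right\<close> holds because no \<open>i + 1\<close> beyond column \<open>x\<close> is
  unpaired.\<close>

locale raising = letter_pair +
  fixes r x :: nat
  assumes J_x: "J r x"
    and x_pos: "0 < x"
    and no_I_x: "\<not> I p x"
    and pair_left: "d < x \<Longrightarrow> I p d \<Longrightarrow> (\<And>d'. d < d' \<Longrightarrow> d' < x \<Longrightarrow> Ex (\<lambda>p. I p d') \<and> Ex (\<lambda>p. J p d'))
      \<Longrightarrow> \<exists>q. J q d"
    and pair_right: "x < d \<Longrightarrow> J p d \<Longrightarrow> (\<And>d'. x < d' \<Longrightarrow> d' < d \<Longrightarrow> Ex (\<lambda>p. I p d') \<and> Ex (\<lambda>p. J p d'))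
      \<Longrightarrow> \<exists>q. I q d"
begin

definition both :: "nat \<Rightarrow> bool" where
  "both d \<longleftrightarrow> (\<exists>p. I p d) \<and> (\<exists>p. J p d)"

definition left_block :: "nat set" where
  "left_block = {d. d < x \<and> (\<forall>d' \<in> {d..<x}. 0 < d' \<and> J r d' \<and> (\<exists>s>r. I s d'))}"

definition right_block :: "nat set" where
  "right_block = {d. x < d \<and> (\<forall>d' \<in> {x<..d}. J r d' \<and> (\<exists>s<r. I s d'))}"

definition block :: "nat set" where
  "block = insert x (left_block \<union> right_block)"

text \<open>Positions after raising. Column \<open>x\<close> obeys the same formula as the swapped
  columns: it holds no \<open>i\<close>, so no \<open>i + 1\<close> remains there.\<close>

definition I' :: "nat \<Rightarrow> nat \<Rightarrow> bool" where
  "I' p c \<longleftrightarrow> (if c \<in> block then p = r else I p c)"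

definition J' :: "nat \<Rightarrow> nat \<Rightarrow> bool" where
  "J' p c \<longleftrightarrow> (if c \<in> block then I p c else J p c)"

section \<open>Row lengths and forced repetitions on both sides of column \<open>x\<close>\<close>

text \<open>Induction from the basement to the right. If row \<open>s\<close> were not shorter, a
  type II triple would repeat its \<open>i\<close> to the left. There the pairing supplies an
  \<open>i + 1\<close>, below row \<open>s\<close> and by induction in a longer row; a type I triple
  carries it into the next column, so its row is \<open>t\<close>.\<close>

lemma I_above_J_shorter:
  assumes "d < x" "\<And>d'. d < d' \<Longrightarrow> d' < x \<Longrightarrow> both d'" "I s d" "J t d" "t < s"
  shows "a s < a t"
  using assms
proof (induction d arbitrary: t)
  case 0
  then show ?case using basement by fastforce
next
  case (Suc d)
  show ?case
  proof (rule ccontr)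
    assume "\<not> a s < a t"
    then have le: "a t \<le> a s" by simp
    have s: "I s d" using I_left_II Suc.prems le by blast
    have b: "both d'" if "d < d'" "d' < x" for d'
      using Suc.prems that by (cases "d' = Suc d") (auto simp: both_def)
    obtain q where q: "J q d"
      using pair_left[OF _ s] b Suc.prems(1) unfolding both_def by auto
    have "q < s" using J_mono[OF q Suc.prems(4)] Suc.prems(5) by simp
    have "a s < a q" using Suc.IH[OF _ b s q \<open>q < s\<close>] Suc.prems(1) by simp
    then have "J q (Suc d)" using J_right_I q s \<open>q < s\<close> by blast
    then have "q = t" using J_unique Suc.prems(4) by blast
    with le \<open>a s < a q\<close> show False by simp
  qed
qed

text \<open>If the \<open>i + 1\<close> of column \<open>d\<close> were in a row below
  \<open>r\<close>, that row would be longer than row \<open>s\<close>, and a type I triple would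
  put a second \<open>i + 1\<close> into column \<open>Suc d\<close>.\<close>

lemma left_end:
  assumes "d < x" "\<And>d'. d < d' \<Longrightarrow> d' < x \<Longrightarrow> both d'" "J r (Suc d)" "I s d" "r \<le> s"
  shows "J r d"
proof -
  obtain t where t: "J t d" using pair_left[OF assms(1,4)] assms(2) unfolding both_def by blast
  have "t \<le> r" using J_mono t assms(3) by blast
  show ?thesis
  proof (cases "t = r")
    case False
    then have "t < s" using \<open>t \<le> r\<close> assms(5) by simp
    then have "J t (Suc d)" using I_above_J_shorter[OF assms(1,2,4) t] J_right_I t assms(4) by blast
    then show ?thesis using J_unique assms(3) False by blast
  qed (use t in simp)
qed

text \<open>A longer row \<open>s\<close> would repeat its \<open>i\<close> to the left by type I
  triples as far as column \<open>x\<close>, which has no \<open>i\<close>.\<close>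

lemma I_below_shorter:
  assumes "x \<le> d" "\<And>d'. x \<le> d' \<Longrightarrow> d' < d \<Longrightarrow> J r d'" "I s d" "s < r"
  shows "a s \<le> a r"
  using assms
proof (induction d rule: dec_induct)
  case base
  then show ?case using no_I_x by blast
next
  case (step d)
  then show ?case using I_left_I[of s d r] by (metis less_Suc_eq not_le)
qed

lemma right_end:
  assumes "x \<le> d" "\<And>d'. x \<le> d' \<Longrightarrow> d' \<le> d \<Longrightarrow> J r d'" "I s (Suc d)" "s < r"
  shows "J r (Suc d)"
  using J_right_II[of r d s] I_below_shorter[of "Suc d" s] assms by simp

text \<open>Otherwise row \<open>r\<close> would contain \<open>i + 1\<close> in all columns to the right.\<close>

lemma no_J_right:
  assumes "x \<le> d" "\<And>d'. x < d' \<Longrightarrow> d' \<le> d \<Longrightarrow> both d'" "\<And>s. I s d \<Longrightarrow> s < r"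
    "\<not> (J r (Suc d) \<and> (\<exists>s<r. I s (Suc d)))"
  shows "\<not> J r (Suc d)"
proof
  assume J: "J r (Suc d)"
  \<comment> \<open>The invariant carries what the next column needs: an \<open>i\<close> above in a
    shorter row for the type I triple, and columns with both letters for
    \<open>pair_right\<close>.\<close>
  have "J r (Suc d + m) \<and> (\<exists>u>r. I u (Suc d + m) \<and> a u < a r) \<and>
    (\<forall>d'. x < d' \<and> d' \<le> Suc d + m \<longrightarrow> both d')" for m
  proof (induction m)
    case 0
    obtain u where u: "I u (Suc d)"
      using pair_right[OF _ J] assms(1,2) unfolding both_def by auto
    have "r < u" using disjoint[OF u] u J assms(4) by (metis linorder_neqE_nat)
    \<comment> \<open>Otherwise a type II triple would repeat the \<open>i\<close> of row
      \<open>u\<close> in column \<open>d\<close>, where every \<open>i\<close> is below row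
      \<open>r\<close>.\<close>
    have "a u < a r" using I_left_II[OF u J \<open>r < u\<close>] assms(3) \<open>r < u\<close> by (meson not_less_iff_gr_or_eq not_le)
    then show ?case using u J \<open>r < u\<close> assms(2) by (auto simp: le_Suc_eq both_def)
  next
    case (Suc m)
    let ?d = "Suc d + m"
    obtain u where u: "J r ?d" "r < u" "I u ?d" "a u < a r" "\<And>d'. x < d' \<Longrightarrow> d' \<le> ?d \<Longrightarrow> both d'"
      using Suc.IH by blast
    have J: "J r (Suc ?d)" using J_right_I u by blast
    obtain v where v: "I v (Suc ?d)"
      using pair_right[OF _ J] assms(1) u(5) unfolding both_def by auto
    have "r < v" using I_mono[OF u(3) v] u(2) by simp
    have "a v < a r"
      using I_left_II[OF v J \<open>r < v\<close>] I_unique[OF u(3), of v] u(4) by fastforce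
    then show ?case using u v J \<open>r < v\<close> by (auto simp: le_Suc_eq both_def)
  qed
  \<comment> \<open>This column lies beyond the end of row \<open>r\<close>.\<close>
  from this[of "a r"] have "J r (Suc d + a r)" by blast
  from J_bound[OF this] show False by simp
qed

section \<open>The block of changed columns and its two ends\<close>

lemma left_blockD:
  assumes "d \<in> left_block"
  shows "d < x" and "d \<le> d' \<Longrightarrow> d' < x \<Longrightarrow> 0 < d' \<and> J r d' \<and> (\<exists>s>r. I s d')"
  using assms unfolding left_block_def by auto

lemma right_blockD:
  assumes "d \<in> right_block"
  shows "x < d" and "x < d' \<Longrightarrow> d' \<le> d \<Longrightarrow> J r d' \<and> (\<exists>s<r. I s d')"
  using assms unfolding right_block_def by auto

lemma block_J:
  assumes "d \<in> block"
  shows "J r d"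
  using assms left_blockD[of d] right_blockD[of d] J_x unfolding block_def by auto

lemma block_both:
  assumes "d \<in> block" "d \<noteq> x"
  shows "both d"
proof -
  consider "d \<in> left_block" | "d \<in> right_block" using assms unfolding block_def by blast
  then have "\<exists>s. I s d"
  proof cases
    case 1
    show ?thesis using left_blockD(1)[OF 1] left_blockD(2)[OF 1, of d] by blast
  next
    case 2
    show ?thesis using right_blockD(1)[OF 2] right_blockD(2)[OF 2, of d] by blast
  qed
  then show ?thesis using block_J[OF assms(1)] unfolding both_def by blast
qed

text \<open>After the swap row \<open>r\<close> holds the \<open>i\<close> and row \<open>s\<close>
  the \<open>i + 1\<close>. Inside the block, these comparisons then contradict the hypotheses of
  the rules that would repeat \<open>i + 1\<close> to the right.\<close>

lemma block_I:
  assumes "d \<in> block" "I s d"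
  shows "d < x \<and> r < s \<and> a s < a r \<or> x < d \<and> s < r \<and> a s \<le> a r"
proof -
  have "d \<noteq> x" using assms no_I_x by blast
  then consider "d \<in> left_block" | "d \<in> right_block" using assms unfolding block_def by blast
  then show ?thesis
  proof cases
    case 1
    then have "d < x" by (rule left_blockD)
    then obtain u where "r < u" "I u d" and J: "J r d" using left_blockD(2)[OF 1, of d] by blast
    then have "r < s" using I_unique assms(2) by blast
    moreover have "both d'" if "d < d'" "d' < x" for d'
      using left_blockD(2)[OF 1, of d'] that unfolding both_def by auto
    ultimately show ?thesis
      using I_above_J_shorter[OF \<open>d < x\<close> _ assms(2) J] \<open>d < x\<close> by blast
  next
    case 2
    then have "x < d" by (rule right_blockD)
    then obtain u where "u < r" "I u d" using right_blockD(2)[OF 2, of d] by blast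
    then have "s < r" using I_unique assms(2) by blast
    moreover have "J r d'" if "x \<le> d'" "d' < d" for d'
      using right_blockD(2)[OF 2, of d'] J_x that by (cases "d' = x") auto
    ultimately show ?thesis
      using I_below_shorter[OF _ _ assms(2)] \<open>x < d\<close> by simp
  qed
qed

lemma zero_notin_block: "0 \<notin> block"
  using x_pos unfolding block_def left_block_def right_block_def by auto

lemma block_interval:
  assumes "d \<in> block" "d \<le> d' \<and> d' \<le> x \<or> x \<le> d' \<and> d' \<le> d"
  shows "d' \<in> block"
  using assms unfolding block_def left_block_def right_block_def by (cases "d' = x") auto

text \<open>The block is maximal to the left: an \<open>i\<close> of column \<open>d\<close> not
  below row \<open>r\<close> would, by \<open>left_end\<close>, make \<open>d\<close> a column of
  the block.\<close>

lemma block_enter: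
  assumes "d \<notin> block" "Suc d \<in> block"
  shows "d < x" and "I s d \<Longrightarrow> s < r" and "J s d \<Longrightarrow> s \<le> r" and "I s (Suc d) \<Longrightarrow> r < s"
proof -
  show "d < x" using assms block_interval by (metis le_SucI not_le order_refl)
  show "J s d \<Longrightarrow> s \<le> r" using J_mono block_J assms by blast
  show "I s (Suc d) \<Longrightarrow> r < s" using block_I[OF assms(2)] \<open>d < x\<close> by fastforce
  have b: "Suc d \<le> d' \<Longrightarrow> d' \<le> x \<Longrightarrow> d' \<in> block" for d'
    using block_interval assms(2) by blast
  show "s < r" if "I s d"
  proof (rule ccontr)
    assume "\<not> s < r"
    then have rs: "r \<le> s" by simp
    have J: "J r d"
      using left_end[OF \<open>d < x\<close> _ block_J[OF assms(2)] that rs] block_both b by simp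
    have "r < s" using rs disjoint[OF that] J by (metis le_neq_implies_less)
    \<comment> \<open>In the basement every \<open>i\<close> is below every
      \<open>i + 1\<close>.\<close>
    have "0 < d" using basement J that rs by (metis gr0I leD)
    have "d' \<in> left_block" if "d < d'" "d' < x" for d'
      using b[of d'] that unfolding block_def right_block_def by auto
    then have "d \<in> left_block"
      using \<open>d < x\<close> \<open>0 < d\<close> J \<open>I s d\<close> \<open>r < s\<close> unfolding left_block_def
      by (auto simp: le_less)
    then show False using assms(1) unfolding block_def by blast
  qed
qed

text \<open>The block is maximal to the right: an \<open>i\<close> below row \<open>r\<close> in
  column \<open>Suc d\<close> would extend it by \<open>right_end\<close>. Then
  \<open>no_J_right\<close> makes the inequality for \<open>i + 1\<close> strict.\<close>

lemma block_exit:
  assumes "d \<in> block" "Suc d \<notin> block"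
  shows "x \<le> d" and "I s (Suc d) \<Longrightarrow> r \<le> s" and "J s (Suc d) \<Longrightarrow> r < s" and "I s d \<Longrightarrow> s < r"
proof -
  show "x \<le> d" using assms block_interval by (metis Suc_leI le_SucI not_le order_refl)
  then show Id: "I s d \<Longrightarrow> s < r" for s using block_I[OF assms(1)] by fastforce
  have b: "x \<le> d' \<Longrightarrow> d' \<le> d \<Longrightarrow> d' \<in> block" for d'
    using block_interval assms(1) by blast
  have rb: "d' \<in> right_block" if "x < d'" "d' \<le> d" for d'
    using b[of d'] that unfolding block_def left_block_def by auto
  have new: "\<not> (J r (Suc d) \<and> (\<exists>s<r. I s (Suc d)))"
  proof
    assume "J r (Suc d) \<and> (\<exists>s<r. I s (Suc d))"
    then have "Suc d \<in> right_block"
      using \<open>x \<le> d\<close> rb unfolding right_block_def by (auto simp: le_Suc_eq)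
    then show False using assms(2) unfolding block_def by blast
  qed
  show "r \<le> s" if "I s (Suc d)"
  proof (rule ccontr)
    assume "\<not> r \<le> s"
    then have "s < r" by simp
    with right_end[OF \<open>x \<le> d\<close> block_J[OF b] that] new that show False by blast
  qed
  have "\<not> J r (Suc d)"
    using no_J_right[OF \<open>x \<le> d\<close> _ Id new] block_both b by simp
  then show "r < s" if "J s (Suc d)"
    using J_mono[OF block_J[OF assms(1)] that] that by (metis le_neq_implies_less)
qed

section \<open>The letters after raising\<close>

text \<open>Each rule is checked according to whether \<open>c\<close> and \<open>Suc c\<close> lie
  in the block. Outside nothing changes; inside, every new \<open>i\<close> is in row
  \<open>r\<close> and \<open>block_I\<close> compares the rows; at the two ends
  \<open>block_enter\<close> and \<open>block_exit\<close> fix the relative positions.\<close>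

lemma raised_letter_pair: "letter_pair a I' J'"
proof
  fix p c q s
  show "\<not> J' p c" if "I' p c"
    using that disjoint block_J unfolding I'_def J'_def by (auto split: if_splits)
  show "p = q" if "I' p c" "I' q c"
    using that I_unique unfolding I'_def J'_def by (auto split: if_splits)
  show "p = q" if "J' p c" "J' q c"
    using that I_unique J_unique unfolding I'_def J'_def by (auto split: if_splits)
  show "p \<le> q" if "I' p c" "I' q (Suc c)"
    using that I_mono[of p c q] block_enter(2)[of c p] block_exit(2)[of c q]
    unfolding I'_def J'_def by (auto split: if_splits)
  show "p \<le> q" if "J' p c" "J' q (Suc c)"
    using that I_mono[of p c q] J_mono[of p c q] block_enter(3)[of c p] block_enter(4)[of c q]
      block_exit(3)[of c q] block_exit(4)[of c p]
    unfolding I'_def J'_def by (auto split: if_splits)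
  show "J' p (Suc c)" if "J' p c" "I' s c" "p < s" "a s < a p"
    using that J_right_I[of p c s] block_I[of c p] block_enter(2)[of c s]
      J_unique[OF block_J, of "Suc c" p]
    unfolding I'_def J'_def by (auto split: if_splits)
  show "J' p (Suc c)" if "J' p c" "I' s (Suc c)" "s < p" "a s \<le> a p"
    using that J_right_II[of p c s] block_I[of c p] block_enter(3)[of c p]
      block_exit(2)[of c s] block_exit(4)[of c p]
    unfolding I'_def J'_def by (auto split: if_splits)
  show "I' p c" if "I' p (Suc c)" "J' s c" "p < s" "a s < a p"
    using that I_left_I[of p c s] block_enter(3)[of c s]
      block_exit(2)[of c p] block_exit(4)[of c s]
    unfolding I'_def J'_def by (auto split: if_splits)
  show "I' p c" if "I' p (Suc c)" "J' s (Suc c)" "s < p" "a s \<le> a p"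
    using that I_left_II[of p c s] block_enter(4)[of c s]
      block_exit(3)[of c s] block_exit(4)[of c p]
    unfolding I'_def J'_def by (auto split: if_splits)
  show "p < q" if "I' p 0" "J' q 0"
    using that zero_notin_block basement unfolding I'_def J'_def by auto
  show "c \<le> a p" if "I' p c"
    using that I_bound J_bound block_J unfolding I'_def J'_def by (auto split: if_splits)
  show "c \<le> a p" if "J' p c"
    using that I_bound J_bound unfolding I'_def J'_def by (auto split: if_splits)
qed

text \<open>If \<open>c\<close> or \<open>Suc c\<close> is in the block, both sides are false:
  inside, the row would be \<open>r\<close>, which does not hold the other letter there; at the
  ends, the strict inequalities put the two letters into different rows.\<close>

lemma raised_ascent: "I' p c \<and> J' p (Suc c) \<longleftrightarrow> I p c \<and> J p (Suc c)"
  using block_I[of c p] block_I[of "Suc c" p] J_unique[OF block_J, of "Suc c" p]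
    block_enter(2,4)[of c p] block_exit(3,4)[of c p]
    block_J[of c] disjoint[of p c]
  unfolding I'_def J'_def by (auto split: if_splits)

end

section \<open>The letters i and i + 1 in a tabloid\<close>

text \<open>The basement is included, so that repetitions to the left can run down to column
  0.\<close>

definition occurs :: "nat \<Rightarrow> (nat \<Rightarrow> nat) \<Rightarrow> filling \<Rightarrow> nat \<Rightarrow> nat \<Rightarrow> nat \<Rightarrow> bool" where
  "occurs n a T v p c \<longleftrightarrow> (p, c) \<in> aug_diagram n a \<and> entry T (p, c) = v"

lemma aug_diagram_iff [simp]: "(p, c) \<in> aug_diagram n a \<longleftrightarrow> 1 \<le> p \<and> p \<le> n \<and> c \<le> a p"
  by (simp add: aug_diagram_def)

lemma diagram_iff [simp]: "(p, c) \<in> diagram n a \<longleftrightarrow> 1 \<le> p \<and> p \<le> n \<and> 1 \<le> c \<and> c \<le> a p"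
  by (simp add: diagram_def)

lemma occurs_unique:
  assumes "non_attacking n a T" "occurs n a T v p c" "occurs n a T v q c"
  shows "p = q"
proof (rule ccontr)
  assume "p \<noteq> q"
  then have "attack (p, c) (q, c)" by simp
  then show False using assms unfolding non_attacking_def occurs_def by metis
qed

lemma occurs_mono:
  assumes "non_attacking n a T" "occurs n a T v p c" "occurs n a T v q (Suc c)"
  shows "p \<le> q"
proof (rule ccontr)
  assume "\<not> p \<le> q"
  then have "attack (p, c) (q, Suc c)" by simp
  then show False using assms unfolding non_attacking_def occurs_def by metis
qed

lemma non_attackingI:
  assumes "\<And>v p q c. occurs n a T v p c \<Longrightarrow> occurs n a T v q c \<Longrightarrow> p = q"
    and "\<And>v p q c. occurs n a T v p c \<Longrightarrow> occurs n a T v q (Suc c) \<Longrightarrow> p \<le> q"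
  shows "non_attacking n a T"
  unfolding non_attacking_def
proof (intro ballI impI notI)
  fix y z assume yz: "y \<in> aug_diagram n a" "z \<in> aug_diagram n a" "attack y z" "entry T y = entry T z"
  obtain p c q d where [simp]: "y = (p, c)" "z = (q, d)" by (cases y, cases z)
  have "occurs n a T (entry T y) p c" "occurs n a T (entry T y) q d"
    using yz unfolding occurs_def by simp_all
  then show False using assms[of _ p c q] yz(3) by auto
qed

text \<open>Only the cyclic order of the three values matters for \<open>coinv_order\<close>.\<close>

lemma coinv_order_adjacent:
  "coinv_order i (Suc i) v \<or> v = i \<or> v = Suc i"
  "coinv_order (Suc i) v i \<or> v = i \<or> v = Suc i"
  "coinv_order v i (Suc i) \<or> v = i \<or> v = Suc i"
  unfolding coinv_order_def by auto

definition same_upto :: "nat \<Rightarrow> nat \<Rightarrow> nat \<Rightarrow> bool" where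
  "same_upto i u v \<longleftrightarrow> u = v \<or> u \<in> {i, Suc i} \<and> v \<in> {i, Suc i}"

text \<open>No number lies strictly between \<open>i\<close> and \<open>Suc i\<close>, so
  comparisons with any other value do not see the exchange.\<close>

lemma same_upto_less:
  assumes "same_upto i x x'" "same_upto i y y'" "x \<notin> {i, Suc i} \<or> y \<notin> {i, Suc i}"
  shows "x < y \<longleftrightarrow> x' < y'"
  using assms unfolding same_upto_def by auto

text \<open>With at most one of the two letters present, all comparisons are preserved. With both
  present, a co-inversion needs \<open>Suc i\<close> to follow \<open>i\<close> in the cyclic
  order.\<close>

lemma coinv_order_same_upto:
  assumes co: "coinv_order x y z" and nco: "\<not> coinv_order x' y' z'"
    and same: "same_upto i x x'" "same_upto i y y'" "same_upto i z z'"
  shows "x = i \<and> y = Suc i \<and> z \<notin> {i, Suc i} \<or> y = i \<and> z = Suc i \<and> x \<notin> {i, Suc i} \<or>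
    z = i \<and> x = Suc i \<and> y \<notin> {i, Suc i}"
proof -
  let ?S = "{i, Suc i}"
  consider "x \<in> ?S" "y \<in> ?S" | "y \<in> ?S" "z \<in> ?S" | "z \<in> ?S" "x \<in> ?S"
    | "x \<notin> ?S \<or> y \<notin> ?S" "y \<notin> ?S \<or> z \<notin> ?S" "z \<notin> ?S \<or> x \<notin> ?S"
    by blast
  then show ?thesis
  proof cases
    case 4
    then have "coinv_order x' y' z'"
      using co same_upto_less[OF same(1,2)] same_upto_less[OF same(2,3)] same_upto_less[OF same(3,1)]
      unfolding coinv_order_def by blast
    with nco show ?thesis by blast
  qed (use co in \<open>auto simp: coinv_order_def\<close>)
qed

text \<open>Each repetition rule comes from one triple: its two known entries leave only
  \<open>i\<close> and \<open>i + 1\<close> for the third cell, and an attacking cell excludes one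
  of these.\<close>

lemma SSKD_letter_pair:
  assumes "T \<in> SSKD n a"
  shows "letter_pair a (occurs n a T i) (occurs n a T (Suc i))"
proof
  have na: "non_attacking n a T" and nc: "no_coinv_triples n a T"
    using assms unfolding SSKD_def by auto
  have attack: "entry T y \<noteq> entry T z \<and> entry T z \<noteq> entry T y"
    if "attack y z" "y \<in> aug_diagram n a" "z \<in> aug_diagram n a" for y z
    using na that unfolding non_attacking_def by metis
  have J_key: "v = Suc i" if "\<not> coinv_order (Suc i) v i" "v \<noteq> i" for v
    using coinv_order_adjacent(2) that by blast
  have I_key: "v = i" if "\<not> coinv_order v i (Suc i)" "v \<noteq> Suc i" for v
    using coinv_order_adjacent(3) that by blast
  have I: "\<not> coinv_order (entry T (p, c)) (entry T (p, Suc c)) (entry T (s, c))"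
    if "(p, Suc c) \<in> aug_diagram n a" "(s, c) \<in> aug_diagram n a" "p < s" "a s < a p" for p c s
    using nc that unfolding no_coinv_triples_def type_I_triple_def by simp
  have II: "\<not> coinv_order (entry T (p, c)) (entry T (p, Suc c)) (entry T (s, Suc c))"
    if "(p, Suc c) \<in> aug_diagram n a" "(s, Suc c) \<in> aug_diagram n a" "s < p" "a s \<le> a p" for p c s
    using nc that unfolding no_coinv_triples_def type_II_triple_def by simp
  fix p c q s
  let ?I = "occurs n a T i" and ?J = "occurs n a T (Suc i)"
  show "\<not> ?J p c" if "?I p c" using that unfolding occurs_def by simp
  show "p = q" if "?I p c" "?I q c" using occurs_unique na that by blast
  show "p = q" if "?J p c" "?J q c" using occurs_unique na that by blast
  show "p \<le> q" if "?I p c" "?I q (Suc c)" using occurs_mono na that by blast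
  show "p \<le> q" if "?J p c" "?J q (Suc c)" using occurs_mono na that by blast
  show "?J p (Suc c)" if "?J p c" "?I s c" "p < s" "a s < a p"
    using that I[of p c s] attack[of "(s, c)" "(p, Suc c)"] J_key[of "entry T (p, Suc c)"]
    unfolding occurs_def by (simp del: entry.simps)
  show "?J p (Suc c)" if "?J p c" "?I s (Suc c)" "s < p" "a s \<le> a p"
    using that II[of p c s] attack[of "(s, Suc c)" "(p, Suc c)"] J_key[of "entry T (p, Suc c)"]
    unfolding occurs_def by (simp del: entry.simps)
  show "?I p c" if "?I p (Suc c)" "?J s c" "p < s" "a s < a p"
    using that I[of p c s] attack[of "(p, c)" "(s, c)"] I_key[of "entry T (p, c)"]
    unfolding occurs_def by (simp del: entry.simps)
  show "?I p c" if "?I p (Suc c)" "?J s (Suc c)" "s < p" "a s \<le> a p"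
    using that II[of p c s] attack[of "(p, c)" "(s, Suc c)"] I_key[of "entry T (p, c)"]
    unfolding occurs_def by (simp del: entry.simps)
  show "p < q" if "?I p 0" "?J q 0" using that unfolding occurs_def by simp
  show "c \<le> a p" if "?I p c" using that unfolding occurs_def by simp
  show "c \<le> a p" if "?J p c" using that unfolding occurs_def by simp
qed

text \<open>A converse: all other values stay in place, so the rules for the two letters and the
  unchanged ascents from \<open>i\<close> to \<open>i + 1\<close> are enough.\<close>

lemma SSKD_maj_transfer:
  assumes T: "T \<in> SSKD n a" and T': "T' \<in> fillings n a"
    and same: "\<And>y. y \<in> aug_diagram n a \<Longrightarrow> same_upto i (entry T' y) (entry T y)"
    and pair: "letter_pair a (occurs n a T' i) (occurs n a T' (Suc i))"
    and ascent: "\<And>p c. occurs n a T' i p c \<and> occurs n a T' (Suc i) p (Suc c) \<longleftrightarrow>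
      occurs n a T i p c \<and> occurs n a T (Suc i) p (Suc c)"
  shows "T' \<in> SSKD n a" and "maj n a T' = maj n a T"
proof -
  interpret letter_pair a "occurs n a T' i" "occurs n a T' (Suc i)" by fact
  have na: "non_attacking n a T" and nc: "no_coinv_triples n a T"
    using T unfolding SSKD_def by auto
  have other: "occurs n a T v p c" if "occurs n a T' v p c" "v \<noteq> i" "v \<noteq> Suc i" for v p c
    using same[of "(p, c)"] that unfolding occurs_def same_upto_def by auto
  have "non_attacking n a T'"
  proof (rule non_attackingI)
    fix v p q c
    show "p = q" if "occurs n a T' v p c" "occurs n a T' v q c"
      using that I_unique J_unique occurs_unique[OF na other other] by blast
    show "p \<le> q" if "occurs n a T' v p c" "occurs n a T' v q (Suc c)"
      using that I_mono J_mono occurs_mono[OF na other other] by blast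
  qed
  moreover have "no_coinv_triples n a T'"
    unfolding no_coinv_triples_def
  proof (intro conjI allI impI notI)
    fix p s c
    assume t: "type_I_triple n a p s c"
      and "coinv_order (entry T' (p, c)) (entry T' (p, c + 1)) (entry T' (s, c))"
    then have co: "coinv_order (entry T' (p, c)) (entry T' (p, Suc c)) (entry T' (s, c))"
      unfolding Suc_eq_plus1 by blast
    have d: "(p, c) \<in> aug_diagram n a" "(p, Suc c) \<in> aug_diagram n a" "(s, c) \<in> aug_diagram n a"
      "p < s" "a s < a p" using t unfolding type_I_triple_def by auto
    have nco: "\<not> coinv_order (entry T (p, c)) (entry T (p, Suc c)) (entry T (s, c))"
      using nc t unfolding no_coinv_triples_def Suc_eq_plus1 by blast
    consider "occurs n a T' i p c" "occurs n a T' (Suc i) p (Suc c)" "entry T' (s, c) \<notin> {i, Suc i}"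
      | "occurs n a T' i p (Suc c)" "occurs n a T' (Suc i) s (c)" "\<not> occurs n a T' i p c"
      | "occurs n a T' i s (c)" "occurs n a T' (Suc i) p c" "\<not> occurs n a T' (Suc i) p (Suc c)"
      using coinv_order_same_upto[OF co nco same same same] d(1-3) unfolding occurs_def by blast
    then show False
    proof cases
      case 1
      \<comment> \<open>The ascent is already present in \<open>T\<close>, so the whole triple
        agrees with that of \<open>T\<close>.\<close>
      then have "entry T (p, c) = entry T' (p, c)" "entry T (p, Suc c) = entry T' (p, Suc c)"
        using ascent[of p c] unfolding occurs_def by simp_all
      moreover have "entry T (s, c) = entry T' (s, c)"
        using same[OF d(3)] 1(3) unfolding same_upto_def by auto
      ultimately show False using co nco by simp
    next
      case 2
      then show False using I_left_I d(4,5) by blast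
    next
      case 3
      then show False using J_right_I d(4,5) by blast
    qed
  next
    fix p s c
    assume t: "type_II_triple n a p s c"
      and "coinv_order (entry T' (p, c)) (entry T' (p, c + 1)) (entry T' (s, c + 1))"
    then have co: "coinv_order (entry T' (p, c)) (entry T' (p, Suc c)) (entry T' (s, Suc c))"
      unfolding Suc_eq_plus1 by blast
    have d: "(p, c) \<in> aug_diagram n a" "(p, Suc c) \<in> aug_diagram n a" "(s, Suc c) \<in> aug_diagram n a"
      "s < p" "a s \<le> a p" using t unfolding type_II_triple_def by auto
    have nco: "\<not> coinv_order (entry T (p, c)) (entry T (p, Suc c)) (entry T (s, Suc c))"
      using nc t unfolding no_coinv_triples_def Suc_eq_plus1 by blast
    consider "occurs n a T' i p c" "occurs n a T' (Suc i) p (Suc c)" "entry T' (s, Suc c) \<notin> {i, Suc i}"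
      | "occurs n a T' i p (Suc c)" "occurs n a T' (Suc i) s (Suc c)" "\<not> occurs n a T' i p c"
      | "occurs n a T' i s (Suc c)" "occurs n a T' (Suc i) p c" "\<not> occurs n a T' (Suc i) p (Suc c)"
      using coinv_order_same_upto[OF co nco same same same] d(1-3) unfolding occurs_def by blast
    then show False
    proof cases
      case 1
      then have "entry T (p, c) = entry T' (p, c)" "entry T (p, Suc c) = entry T' (p, Suc c)"
        using ascent[of p c] unfolding occurs_def by simp_all
      moreover have "entry T (s, Suc c) = entry T' (s, Suc c)"
        using same[OF d(3)] 1(3) unfolding same_upto_def by auto
      ultimately show False using co nco by simp
    next
      case 2
      then show False using I_left_II d(4,5) by blast
    next
      case 3
      then show False using J_right_II d(4,5) by blast
    qed
  qed
  ultimately show "T' \<in> SSKD n a" using T' unfolding SSKD_def by simp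
  show "maj n a T' = maj n a T"
    unfolding maj_def
  proof (rule sum.cong)
    \<comment> \<open>Only a comparison of two entries from \<open>{i, Suc i}\<close> can change,
      and there an ascent is an \<open>i\<close> followed by \<open>Suc i\<close>.\<close>
    have "entry T' (p, c) < entry T' (p, c + 1) \<longleftrightarrow> entry T (p, c) < entry T (p, c + 1)"
      if d: "(p, c) \<in> aug_diagram n a" "(p, c + 1) \<in> diagram n a" for p c
    proof -
      have d': "(p, c) \<in> aug_diagram n a" "(p, Suc c) \<in> aug_diagram n a" using d by simp_all
      show ?thesis
        using same[OF d'(1)] same[OF d'(2)] ascent[of p c] d'
        unfolding same_upto_def occurs_def by (auto simp del: entry.simps)
    qed
    then show "{(r, c). (r, c) \<in> aug_diagram n a \<and> (r, c + 1) \<in> diagram n a \<and>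
        entry T' (r, c) < entry T' (r, c + 1)} =
      {(r, c). (r, c) \<in> aug_diagram n a \<and> (r, c + 1) \<in> diagram n a \<and>
        entry T (r, c) < entry T (r, c + 1)}" by blast
  qed simp
qed

section \<open>The pairing rule\<close>

lemma occurs_iff_diagram:
  "0 < c \<Longrightarrow> occurs n a T v p c \<longleftrightarrow> (p, c) \<in> diagram n a \<and> T (p, c) = v"
  unfolding occurs_def by auto

lemma i_pairs_entries:
  "(y, z) \<in> i_pairs n a i T k \<Longrightarrow>
    y \<in> diagram n a \<and> z \<in> diagram n a \<and> T y = i \<and> T z = Suc i \<and> snd y \<le> snd z"
  by (induction k) (auto simp: Let_def)

lemma i_pairs_column:
  assumes "(p, c) \<in> diagram n a" "T (p, c) = i" "(q, c) \<in> diagram n a" "T (q, c) = Suc i"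
  shows "((p, c), (q, c)) \<in> i_pairs n a i T k"
  using assms by (induction k) (auto simp: Let_def)

lemma paired_by_column:
  assumes "0 < c" "occurs n a T i p c" "occurs n a T (Suc i) q c"
    and "non_attacking n a T" "(u, c) \<in> diagram n a" "T (u, c) \<in> {i, Suc i}"
  shows "paired_by (i_pairs n a i T k) (u, c)"
proof -
  have "occurs n a T (T (u, c)) u c" using assms(1,5) occurs_iff_diagram by blast
  then have "u = p \<or> u = q" using assms(2,3,6) occurs_unique[OF assms(4)] by auto
  moreover have "((p, c), (q, c)) \<in> i_pairs n a i T k"
    using assms(1-3) i_pairs_column occurs_iff_diagram by blast
  ultimately show ?thesis unfolding paired_by_def by force
qed

lemma unpaired_succ_raising:
  assumes T: "T \<in> SSKD n a" and "1 \<le> i" "i < n"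
    and unpaired: "(r, x) \<in> unpaired_succ n a i T"
    and rightmost: "\<forall>y \<in> unpaired_succ n a i T. snd y \<le> x"
  shows "raising a (occurs n a T i) (occurs n a T (Suc i)) r x"
proof -
  let ?M = "i_pairs n a i T" and ?I = "occurs n a T i" and ?J = "occurs n a T (Suc i)"
  interpret letter_pair a ?I ?J by (rule SSKD_letter_pair[OF T])
  have na: "non_attacking n a T" using T unfolding SSKD_def by simp
  have rx: "(r, x) \<in> diagram n a" "T (r, x) = Suc i" using unpaired unfolding unpaired_succ_def by auto
  then have "0 < x" by simp
  have unp: "\<not> paired_by (?M k) (r, x)" for k
    using unpaired unfolding unpaired_succ_def paired_by_def by auto
  have no_I: "\<not> ?I p x" for p
    using unp paired_by_column[OF \<open>0 < x\<close> _ _ na rx(1)] rx occurs_iff_diagram[OF \<open>0 < x\<close>] by blast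
  show ?thesis
  proof
    show "?J r x" using rx occurs_iff_diagram \<open>0 < x\<close> by blast
    show "0 < x" by fact
    show "\<not> ?I p x" for p by (rule no_I)
  next
    fix d p
    assume d: "d < x" "?I p d"
      and between: "\<And>d'. d < d' \<Longrightarrow> d' < x \<Longrightarrow> Ex (\<lambda>p. ?I p d') \<and> Ex (\<lambda>p. ?J p d')"
    show "\<exists>q. ?J q d"
    proof (cases "d = 0")
      case True
      then have "?J (Suc i) d" using assms(3) unfolding occurs_def by simp
      then show ?thesis by blast
    next
      case False
      show ?thesis
      proof (rule ccontr)
        assume no_J: "\<nexists>q. ?J q d"
        have pd: "(p, d) \<in> diagram n a" "T (p, d) = i" using d False occurs_iff_diagram by auto
        have "\<not> paired_by (?M 0) (p, d)"
        proof
          assume "paired_by (?M 0) (p, d)"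
          then obtain q e where "((p, d), (q, e)) \<in> ?M 0 \<or> ((q, e), (p, d)) \<in> ?M 0"
            unfolding paired_by_def by force
          moreover have "((q, e), (p, d)) \<notin> ?M 0"
            using i_pairs_entries pd(2) by (metis n_not_Suc_n)
          ultimately have "(q, d) \<in> diagram n a" "T (q, d) = Suc i"
            by auto
          then show False using no_J False occurs_iff_diagram by blast
        qed
        moreover have "paired_by (?M 0) z"
          if z: "z \<in> diagram n a" "T z \<in> {i, i + 1}" "d < snd z" "snd z < x" for z
          using between[OF z(3,4)] paired_by_column[of "snd z" n a T i _ _ "fst z" 0] na z by auto
        \<comment> \<open>After round 0 both cells are unpaired and all letters strictly between
          them are paired, so round 1 already joins them.\<close>
        ultimately have "((p, d), (r, x)) \<in> ?M (Suc 0)"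
          using pd rx d(1) unp[of 0] unfolding i_pairs.simps(2) Let_def
          by (auto simp del: i_pairs.simps diagram_iff)
        then show False using unp[of "Suc 0"] unfolding paired_by_def by force
      qed
    qed
  next
    fix d p
    assume d: "x < d" "?J p d"
      and between: "\<And>d'. x < d' \<Longrightarrow> d' < d \<Longrightarrow> Ex (\<lambda>p. ?I p d') \<and> Ex (\<lambda>p. ?J p d')"
    show "\<exists>q. ?I q d"
    proof (rule ccontr)
      assume no_Id: "\<nexists>q. ?I q d"
      have pd: "(p, d) \<in> diagram n a" "T (p, d) = Suc i" using d occurs_iff_diagram[of d] by auto
      \<comment> \<open>A partner left of column \<open>x\<close> is cut off by the unpaired
        \<open>(r, x)\<close>, column \<open>x\<close> has no \<open>i\<close>, and any
        \<open>i\<close> between \<open>x\<close> and \<open>d\<close> is paired within its column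
        from round 0 on.\<close>
      have "(y, (p, d)) \<notin> ?M k" for y k
      proof (induction k)
        case 0
        show ?case using no_Id d(1) occurs_iff_diagram[of d n a T i] by (cases y) auto
      next
        case (Suc k)
        show ?case
        proof
          assume "(y, (p, d)) \<in> ?M (Suc k)"
          then have y: "y \<in> diagram n a" "T y = i" "snd y < d" "\<not> paired_by (?M k) y"
            and mid: "\<forall>z \<in> diagram n a. T z \<in> {i, i + 1} \<and> snd y < snd z \<and> snd z < d \<longrightarrow> paired_by (?M k) z"
            using Suc.IH by (auto simp: Let_def simp del: diagram_iff)
          obtain s e where [simp]: "y = (s, e)" by (cases y)
          have "0 < e" using y(1) by simp
          then have "?I s e" using y occurs_iff_diagram by auto
          consider "e < x" | "e = x" | "x < e" by linarith
          then show False
          proof cases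
            case 1
            then show False using mid rx d(1) unp[of k] by (auto simp del: diagram_iff)
          next
            case 2
            then show False using no_I \<open>?I s e\<close> by blast
          next
            case 3
            then obtain q where "?J q e" using between[of e] y(3) by auto
            then show False
              using paired_by_column[OF \<open>0 < e\<close> \<open>?I s e\<close> _ na] y by auto
          qed
        qed
      qed
      moreover have "((p, d), z) \<notin> ?M k" for z k using i_pairs_entries pd(2) by (metis n_not_Suc_n)
      ultimately have "(p, d) \<in> unpaired_succ n a i T"
        using pd unfolding unpaired_succ_def paired_by_def by (auto simp del: diagram_iff)
      then show False using rightmost d(1) by fastforce
    qed
  qed
qed

section \<open>The raising operator as an exchange along the block\<close>

theorem theorem5p11:
  fixes n i :: nat and a :: "nat \<Rightarrow> nat" and T T' :: filling
  assumes "1 \<le> i" and "i < n"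
    and "T \<in> SSKD n a"
    and "raise n a i T = Some T'"
  shows "T' \<in> SSKD n a \<and> maj n a T' = maj n a T"
proof -
  let ?I = "occurs n a T i" and ?J = "occurs n a T (Suc i)"
  have na: "non_attacking n a T" and fill: "T \<in> fillings n a" using assms(3) unfolding SSKD_def by auto
  have nonempty: "unpaired_succ n a i T \<noteq> {}" using assms(4) unfolding raise_def by auto
  obtain r x where rx: "rightmost_unpaired n a i T = (r, x)" by fastforce
  have unpaired: "(r, x) \<in> unpaired_succ n a i T"
    and rightmost: "\<forall>y \<in> unpaired_succ n a i T. snd y \<le> x"
    using rightmost_unpaired_props[OF na nonempty] rx by simp_all
  interpret raising a ?I ?J r x
    by (rule unpaired_succ_raising[OF assms(3,1,2) unpaired rightmost])
  have d_rx: "(r, x) \<in> diagram n a" "T (r, x) = Suc i"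
    using unpaired unfolding unpaired_succ_def by auto
  \<comment> \<open>\<open>P\<close> will say that the row is above or below \<open>r\<close>. The
    condition \<open>0 < c\<close> is needed on the right because \<open>occurs\<close> also sees
    the basement.\<close>
  have column: "(r, c) \<in> diagram n a \<and> T (r, c) = i + 1 \<and> (\<exists>s. P s \<and> (s, c) \<in> diagram n a \<and> T (s, c) = i)
    \<longleftrightarrow> 0 < c \<and> ?J r c \<and> (\<exists>s. P s \<and> ?I s c)" for c P
    by (cases "c = 0") (auto simp: occurs_def)
  have left: "left_swap_cols n a i T (r, x) = left_block"
    unfolding left_swap_cols_def left_block_def by (simp only: column fst_conv snd_conv)
  have right: "right_swap_cols n a i T (r, x) = right_block"
    unfolding right_swap_cols_def right_block_def
    using x_pos by (auto simp only: column fst_conv snd_conv greaterThanAtMost_iff)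
  \<comment> \<open>Neither half of the block contains \<open>x\<close>, so the swapped columns are
    exactly \<open>block - {x}\<close>.\<close>
  have T': "T' y = (if y = (r, x) then i
      else if y \<in> diagram n a \<and> snd y \<in> block - {x} then transpose i (Suc i) (T y) else T y)" for y
    using assms(4) nonempty rx left right left_blockD(1)[of x] right_blockD(1)[of x]
    unfolding raise_def block_def by (auto simp: Let_def)
  have "occurs n a T' i p c = I' p c \<and> occurs n a T' (Suc i) p c = J' p c" for p c
  proof (cases "c \<in> block")
    case True
    then have c: "0 < c" using zero_notin_block by (cases c) auto
    have J: "?J p c \<longleftrightarrow> p = r" for p using block_J[OF True] J_unique by blast
    then have r: "(r, c) \<in> diagram n a" using c occurs_iff_diagram by blast
    note occ = occurs_iff_diagram[OF c]
    show ?thesis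
    proof (cases "c = x")
      case True
      have no_I: "\<not> ?I p c" using no_I_x True by simp
      show ?thesis
      proof (cases "p = r")
        case True
        then show ?thesis
          using no_I r T'[of "(p, c)"] \<open>c = x\<close> \<open>c \<in> block\<close> unfolding I'_def J'_def occ by simp
      next
        case False
        then have "T' (p, c) = T (p, c)" using T'[of "(p, c)"] \<open>c = x\<close> by simp
        then show ?thesis
          using no_I J[of p] False \<open>c \<in> block\<close> unfolding I'_def J'_def occ by auto
      qed
    next
      case False
      then have T'_pc: "(p, c) \<in> diagram n a \<Longrightarrow> T' (p, c) = transpose i (Suc i) (T (p, c))"
        using T'[of "(p, c)"] \<open>c \<in> block\<close> by simp
      have "transpose i (Suc i) v = i \<longleftrightarrow> v = Suc i" "transpose i (Suc i) v = Suc i \<longleftrightarrow> v = i" for v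
        unfolding transpose_def by auto
      then show ?thesis
        using T'_pc J[of p] r \<open>c \<in> block\<close> unfolding I'_def J'_def occ
        by (cases "(p, c) \<in> diagram n a") (auto simp del: diagram_iff)
    qed
  next
    case False
    then have "T' (p, c) = T (p, c)" using T'[of "(p, c)"] unfolding block_def by auto
    then show ?thesis using False unfolding I'_def J'_def occurs_def by simp
  qed
  then have I'_eq: "occurs n a T' i = I'" and J'_eq: "occurs n a T' (Suc i) = J'"
    by (simp_all add: fun_eq_iff)
  have "T' \<in> fillings n a"
    unfolding fillings_def
  proof (rule PiE_I)
    fix y
    show "T' y \<in> {1..n}" if "y \<in> diagram n a"
      using PiE_mem[OF fill[unfolded fillings_def] that] assms(1,2) T'[of y]
      unfolding transpose_def by auto
    \<comment> \<open>\<open>(r, x)\<close> is in the diagram, so cells outside keep their default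
      value.\<close>
    show "T' y = undefined" if "y \<notin> diagram n a"
      using PiE_arb[OF fill[unfolded fillings_def] that] T'[of y] d_rx that by auto
  qed
  moreover have "same_upto i (entry T' y) (entry T y)" for y
    using T'[of y] d_rx unfolding same_upto_def transpose_def by (cases y) auto
  ultimately show ?thesis
    using SSKD_maj_transfer[OF assms(3), of T' i] raised_letter_pair raised_ascent
    unfolding I'_eq J'_eq by blast
qed

end
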